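(* Let $G_n$ denote the number of binary words of length $n$ that are cubefree and contain no square $xx$ with $|x|\ge 4$. Then $G_n=\Omega(1.002^n)$ and $G_n=O(1.178^n)$.
   Context: A square is a nonempty word $xx$ and a cube a nonempty word $xxx$ (as contiguous subwords); cubefree means containing no cube. *)

theory Defs
  imports "HOL-Library.Sublist" "HOL-Library.Landau_Symbols"
begin

text \<open>
  The predicate \<^const>\<open>sublist\<close> of the library is the contiguous subword (factor) relation.
\<close>

definition is_square :: "'a list \<Rightarrow> bool" where
  "is_square w \<longleftrightarrow> (\<exists>x. x \<noteq> [] \<and> w = x @ x)"

definition is_cube :: "'a list \<Rightarrow> bool" where
  "is_cube w \<longleftrightarrow> (\<exists>x. x \<noteq> [] \<and> w = x @ x @ x)"

definition cubefree :: "'a list \<Rightarrow> bool" where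
  "cubefree w \<longleftrightarrow> (\<nexists>u. is_cube u \<and> sublist u w)"

definition avoids_squares_ge :: "nat \<Rightarrow> 'a list \<Rightarrow> bool" where
  "avoids_squares_ge k w \<longleftrightarrow>
     (\<nexists>x. length x \<ge> k \<and> is_square (x @ x) \<and> sublist (x @ x) w)"

definition G :: "nat \<Rightarrow> nat" where
  "G n = card {w :: bool list. length w = n \<and> cubefree w \<and> avoids_squares_ge 4 w}"

end

theory Submission
  imports Defs
begin

text \<open>
  Lower bound: a uniform substitution sends a squarefree ternary word \<open>w\<close> to binary words, with two
  possible images for one of the letters. All images start with a common marker that occurs in
  products of images only at block boundaries. A square \<open>xx\<close> with \<open>x\<close> long therefore has a period
  that is a multiple of the block length, and since images of different letters differ both in
  their first and in their second part, it would pull back to a square in \<open>w\<close>; the short squares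
  and cubes lie in four consecutive blocks and are excluded by computation. The same argument, applied to a
  marked substitution on three letters, yields arbitrarily long squarefree ternary words. As every
  four consecutive letters of \<open>w\<close> include the letter with two images, there are at least \<open>2 ^ k\<close>
  admissible words of length \<open>4 \<sqdot> 42 \<sqdot> k\<close>, and \<open>2 > 1.002 ^ 168\<close>.

  Upper bound: reading a word from left to right, one remembers a suffix belonging to a finite
  prefix-closed set. Weights \<open>v\<close> on these suffixes such that the successors of each suffix have
  total weight at most \<open>1.178 v\<close> bound the number of extensions of length \<open>n\<close> by
  \<open>v \<sqdot> 1.178 ^ n\<close>.
\<close>

section \<open>Runs\<close>

text \<open>\<open>has_run u s p l\<close> says that the factor of length \<open>p + l\<close> at position \<open>s\<close> has period \<open>p\<close>;
  squares are the case \<open>l = p\<close>, cubes the case \<open>l = 2 * p\<close>.\<close>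

definition has_run :: "'a list \<Rightarrow> nat \<Rightarrow> nat \<Rightarrow> nat \<Rightarrow> bool" where
  "has_run u s p l \<longleftrightarrow> s + p + l \<le> length u \<and> (\<forall>j<l. u ! (s + j) = u ! (s + p + j))"

text \<open>The forbidden length may depend on the period, so that one predicate covers both
  squarefreeness and the mixed condition given by \<open>cube_bound\<close>.\<close>

definition avoids_runs :: "(nat \<Rightarrow> nat) \<Rightarrow> 'a list \<Rightarrow> bool" where
  "avoids_runs f u \<longleftrightarrow> (\<forall>p s. 0 < p \<longrightarrow> \<not> has_run u s p (f p))"

text \<open>The lengths are unary numbers, so that the simplifier evaluates the recursion
  purely by matching; \<open>c\<close> counts down the agreements still missing for a run of length \<open>l\<close>.\<close>

fun no_run :: "unit list \<Rightarrow> unit list \<Rightarrow> 'a list \<Rightarrow> 'a list \<Rightarrow> bool" where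
  "no_run l [] xs ys = False"
| "no_run l (i # c) [] ys = True"
| "no_run l (i # c) (x # xs) [] = True"
| "no_run l (i # c) (x # xs) (y # ys) = (if x = y then no_run l c xs ys else no_run l l xs ys)"

text \<open>The first conjunct concerns the agreement in progress, the second all starts. A mismatch
  destroys every unfinished run, so the counter may restart at \<open>l\<close>. A run of length
  \<open>l\<close> from the head contains the \<open>length c\<close> agreements still missing,
  which settles the start \<open>s = 0\<close>.\<close>

lemma no_run_sound:
  assumes "no_run l c xs ys" "length c \<le> length l"
  shows "\<not> (length c \<le> length xs \<and> length c \<le> length ys \<and> (\<forall>j<length c. xs ! j = ys ! j)) \<and>
    (\<forall>s. \<not> (s + length l \<le> length xs \<and> s + length l \<le> length ys \<and>
      (\<forall>j<length l. xs ! (s + j) = ys ! (s + j))))"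
  using assms
proof (induction l c xs ys rule: no_run.induct)
  case (4 l i c x xs y ys)
  let ?A = "\<lambda>c xs ys. \<not> (length c \<le> length xs \<and> length c \<le> length ys \<and> (\<forall>j<length c. xs ! j = ys ! j))"
  let ?B = "\<lambda>xs ys. \<forall>s. \<not> (s + length l \<le> length xs \<and> s + length l \<le> length ys \<and>
    (\<forall>j<length l. xs ! (s + j) = ys ! (s + j)))"
  have IH: "(if x = y then ?A c xs ys else ?A l xs ys) \<and> ?B xs ys"
    using 4 by (auto split: if_splits)
  have A: "?A (i # c) (x # xs) (y # ys)"
    using IH by (force simp: All_less_Suc2)
  have "\<not> (s + length l \<le> length (x # xs) \<and> s + length l \<le> length (y # ys) \<and>
    (\<forall>j<length l. (x # xs) ! (s + j) = (y # ys) ! (s + j)))" for s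
  proof (cases s)
    case 0
    then show ?thesis using A 4(4) by force
  next
    case (Suc s')
    then show ?thesis using IH[THEN conjunct2, rule_format, of s'] by auto
  qed
  then show ?case using A by blast
qed auto

lemma no_run_imp_not_has_run:
  assumes "no_run l l u (drop p u)"
  shows "\<not> has_run u s p (length l)"
  using no_run_sound[OF assms order.refl, THEN conjunct2, rule_format, of s]
  by (auto simp: has_run_def add_ac)

text \<open>The intended \<open>ys\<close> is \<open>u\<close> shifted by the current period, whose
  bound heads the list; each step drops one letter and moves to the next period. Once
  \<open>ys\<close> is empty the period is at least \<open>length u\<close>, and only a run of
  length 0 could fit.\<close>

fun no_runs :: "unit list list \<Rightarrow> 'a list \<Rightarrow> 'a list \<Rightarrow> bool" where
  "no_runs [] u ys = True"
| "no_runs (l # ls) u [] = ([] \<notin> set (l # ls))"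
| "no_runs (l # ls) u (y # ys) = (no_run l l u (y # ys) \<and> no_runs ls u ys)"

lemma no_runs_sound:
  assumes "no_runs ls u (drop p u)" "k < length ls"
  shows "\<not> has_run u s (p + k) (length (ls ! k))"
  using assms
proof (induction ls arbitrary: p k)
  case (Cons l ls)
  show ?case
  proof (cases "p < length u")
    case True
    then have "drop p u = u ! p # drop (Suc p) u"
      by (simp add: Cons_nth_drop_Suc)
    then have "no_run l l u (drop p u)" "no_runs ls u (drop (Suc p) u)"
      using Cons.prems(1) by simp_all
    then show ?thesis
      using no_run_imp_not_has_run[of l u p] Cons.IH[of "Suc p" "k - 1"] Cons.prems(2)
      by (cases k) auto
  next
    case False
    then have "[] \<notin> set (l # ls)"
      using Cons.prems(1) by simp
    then have "(l # ls) ! k \<noteq> []"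
      using Cons.prems(2) by (metis nth_mem)
    then show ?thesis
      using False by (cases "(l # ls) ! k") (auto simp: has_run_def)
  qed
qed simp

fun no_short_runs :: "unit list list \<Rightarrow> 'a list \<Rightarrow> bool" where
  "no_short_runs ls [] = ([] \<notin> set ls)"
| "no_short_runs ls (x # xs) = no_runs ls (x # xs) xs"

lemma no_short_runs_eq: "no_short_runs ls u = no_runs ls u (drop 1 u)"
  by (cases u; cases ls) auto

definition run_bounds :: "(nat \<Rightarrow> nat) \<Rightarrow> nat \<Rightarrow> unit list list" where
  "run_bounds f n = map (\<lambda>p. replicate (f p) ()) [1..<n]"

lemma no_short_runs_sound:
  assumes "no_short_runs (run_bounds f n) u" "0 < p" "p < n"
  shows "\<not> has_run u s p (f p)"
  using no_runs_sound[of "run_bounds f n" u 1 "p - 1" s] assms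
  by (simp add: no_short_runs_eq run_bounds_def)

section \<open>Runs in factors, squares and cubes\<close>

lemma has_run_append:
  "has_run v s p l \<Longrightarrow> has_run (u @ v @ w) (length u + s) p l"
  by (auto simp: has_run_def nth_append add.assoc)

lemma avoids_runs_sublist:
  assumes "avoids_runs f w" "sublist v w"
  shows "avoids_runs f v"
  using assms by (auto simp: avoids_runs_def sublist_def dest: has_run_append)

lemma has_run_mono: "has_run u s p l \<Longrightarrow> l' \<le> l \<Longrightarrow> has_run u s p l'"
  by (auto simp: has_run_def)

lemma has_run_square_iff:
  "(\<exists>s. has_run w s p p) \<longleftrightarrow> (\<exists>x. length x = p \<and> sublist (x @ x) w)"
proof
  assume "\<exists>s. has_run w s p p"
  then obtain s where s: "s + p + p \<le> length w" "\<And>j. j < p \<Longrightarrow> w ! (s + j) = w ! (s + p + j)"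
    by (auto simp: has_run_def)
  have eq: "take p (drop (s + p) w) = take p (drop s w)"
    using s by (intro nth_equalityI) auto
  have split: "drop k w = take p (drop k w) @ drop (k + p) w" for k
    by (metis add.commute append_take_drop_id drop_drop)
  have "w = take s w @ take p (drop s w) @ take p (drop (s + p) w) @ drop (s + p + p) w"
    unfolding split[symmetric] by simp
  then have "w = take s w @ (take p (drop s w) @ take p (drop s w)) @ drop (s + p + p) w"
    using eq by simp
  moreover have "length (take p (drop s w)) = p"
    using s by simp
  ultimately show "\<exists>x. length x = p \<and> sublist (x @ x) w"
    unfolding sublist_def by blast
next
  assume "\<exists>x. length x = p \<and> sublist (x @ x) w"
  then obtain x u v where "length x = p" "w = u @ (x @ x) @ v"
    by (auto simp: sublist_def)
  moreover have "has_run (x @ x) 0 (length x) (length x)"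
    by (auto simp: has_run_def nth_append)
  ultimately show "\<exists>s. has_run w s p p"
    using has_run_append by blast
qed

lemma has_run_cube_iff:
  "(\<exists>s. has_run w s p (2 * p)) \<longleftrightarrow> (\<exists>x. length x = p \<and> sublist (x @ x @ x) w)"
proof
  assume "\<exists>s. has_run w s p (2 * p)"
  then obtain s where s: "s + 3 * p \<le> length w" "\<And>j. j < 2 * p \<Longrightarrow> w ! (s + j) = w ! (s + p + j)"
    by (force simp: has_run_def)
  have eq1: "take p (drop (s + p) w) = take p (drop s w)"
    using s by (intro nth_equalityI) auto
  have eq2: "take p (drop (s + p + p) w) = take p (drop (s + p) w)"
  proof (intro nth_equalityI)
    fix i assume "i < length (take p (drop (s + p + p) w))"
    then show "take p (drop (s + p + p) w) ! i = take p (drop (s + p) w) ! i"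
      using s(1) s(2)[of "p + i"] by (simp add: add.assoc)
  qed (use s(1) in simp)
  have split: "drop k w = take p (drop k w) @ drop (k + p) w" for k
    by (metis add.commute append_take_drop_id drop_drop)
  have "w = take s w @ take p (drop s w) @ take p (drop (s + p) w) @ take p (drop (s + p + p) w) @
    drop (s + p + p + p) w"
    unfolding split[symmetric] by simp
  then have "w = take s w @ (take p (drop s w) @ take p (drop s w) @ take p (drop s w)) @ drop (s + p + p + p) w"
    using eq1 eq2 by simp
  moreover have "length (take p (drop s w)) = p"
    using s by simp
  ultimately show "\<exists>x. length x = p \<and> sublist (x @ x @ x) w"
    unfolding sublist_def by blast
next
  assume "\<exists>x. length x = p \<and> sublist (x @ x @ x) w"
  then obtain x u v where "length x = p" "w = u @ (x @ x @ x) @ v"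
    by (auto simp: sublist_def)
  moreover have "has_run (x @ x @ x) 0 (length x) (2 * length x)"
    by (auto simp: has_run_def nth_append)
  ultimately show "\<exists>s. has_run w s p (2 * p)"
    using has_run_append by blast
qed

abbreviation squarefree :: "'a list \<Rightarrow> bool" where
  "squarefree \<equiv> avoids_runs (\<lambda>p. p)"

text \<open>A cube of period at least 4 contains a square of that period, which is already
  forbidden; so the cube condition matters for periods 1 to 3 only.\<close>

definition cube_bound :: "nat \<Rightarrow> nat" where
  "cube_bound p = (if p < 4 then 2 * p else p)"

abbreviation good :: "'a list \<Rightarrow> bool" where
  "good \<equiv> avoids_runs cube_bound"

lemma cubefree_avoids_squares_iff_good:
  "cubefree w \<and> avoids_squares_ge 4 w \<longleftrightarrow> good w"
proof -
  have c: "cubefree w \<longleftrightarrow> (\<forall>p>0. \<nexists>s. has_run w s p (2 * p))"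
    unfolding has_run_cube_iff cubefree_def is_cube_def by (metis length_greater_0_conv)
  have q: "avoids_squares_ge 4 w \<longleftrightarrow> (\<forall>p\<ge>4. \<nexists>s. has_run w s p p)"
    unfolding has_run_square_iff avoids_squares_ge_def is_square_def
    by (metis list.size(3) not_numeral_le_zero)
  have "has_run w s p (2 * p) \<Longrightarrow> has_run w s p p" for s p
    by (erule has_run_mono) simp
  then have "cubefree w \<and> avoids_squares_ge 4 w \<longleftrightarrow>
    (\<forall>p>0. if p < 4 then \<nexists>s. has_run w s p (2 * p) else \<nexists>s. has_run w s p p)"
    unfolding c q by (meson not_le order.strict_trans2 zero_less_numeral)
  then show ?thesis
    unfolding avoids_runs_def cube_bound_def by (auto split: if_splits)
qed

lemma G_eq_card_good: "G n = card {w :: bool list. length w = n \<and> good w}"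
  by (simp add: G_def cubefree_avoids_squares_iff_good)

lemma finite_words: "finite {w :: bool list. length w = n \<and> Q w}"
  by (rule finite_subset[OF _ finite_lists_length_eq[of "UNIV :: bool set" n]]) auto

lemma concat_nth_uniform:
  assumes "\<forall>z\<in>set zs. length z = L" "q < length zs" "r < L"
  shows "concat zs ! (L * q + r) = zs ! q ! r"
  using assms
proof (induction zs arbitrary: q)
  case (Cons z zs)
  then show ?case
    by (cases q) (auto simp: nth_append)
qed simp

lemma length_concat_uniform:
  "\<forall>z\<in>set zs. length z = L \<Longrightarrow> length (concat zs) = L * length zs"
  by (induction zs) auto

section \<open>Substitutions with a marker\<close>

text \<open>\<open>H a\<close> lists the possible images of \<open>a\<close>, and \<open>t\<close>
  cuts each image into two parts that both identify the letter. In an image word every block but the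
  last is followed by \<open>P\<close>, which is why \<open>marker_unique\<close> examines
  \<open>X @ P\<close>. Runs of period below \<open>L + length P - 1\<close> fit into four blocks
  and are left to computation.\<close>

locale marked_substitution =
  fixes H :: "'a \<Rightarrow> 'b list list" and P :: "'b list" and L t :: nat and f :: "nat \<Rightarrow> nat"
  assumes length_block: "X \<in> set (H a) \<Longrightarrow> length X = L"
    and block_marker: "X \<in> set (H a) \<Longrightarrow> take (length P) X = P"
    and marker_unique: "X \<in> set (H a) \<Longrightarrow> 0 < i \<Longrightarrow> i < L \<Longrightarrow> take (length P) (drop i (X @ P)) \<noteq> P"
    and prefixes_differ: "X \<in> set (H a) \<Longrightarrow> Y \<in> set (H b) \<Longrightarrow> a \<noteq> b \<Longrightarrow> take t X \<noteq> take t Y"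
    and suffixes_differ: "X \<in> set (H a) \<Longrightarrow> Y \<in> set (H b) \<Longrightarrow> a \<noteq> b \<Longrightarrow> drop t X \<noteq> drop t Y"
    and marker_length: "0 < length P" "length P \<le> L"
    and t_le: "t \<le> L"
    and period_le: "p \<le> f p"
    and short_run_length: "p < L + length P - 1 \<Longrightarrow> p + f p \<le> 3 * L + 1"
    and short_runs: "squarefree w \<Longrightarrow> length w = 4 \<Longrightarrow> zs \<in> set (product_lists (map H w)) \<Longrightarrow>
      0 < p \<Longrightarrow> p < L + length P - 1 \<Longrightarrow> \<not> has_run (concat zs) s p (f p)"
begin

section \<open>Images of a fixed word: alignment of markers and squares pulled back\<close>

context
  fixes w :: "'a list" and zs :: "'b list list"
  assumes zs: "zs \<in> set (product_lists (map H w))"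
begin

lemma length_zs: "length zs = length w"
  using in_set_product_lists_length[OF zs] by simp

lemma zs_nth: "q < length w \<Longrightarrow> zs ! q \<in> set (H (w ! q))"
  using zs by (auto simp: product_lists_set list_all2_conv_all_nth)

lemma zs_uniform: "\<forall>z\<in>set zs. length z = L"
  using zs_nth length_zs length_block by (metis in_set_conv_nth)

lemma image_nth: "q < length w \<Longrightarrow> r < L \<Longrightarrow> concat zs ! (L * q + r) = zs ! q ! r"
  using concat_nth_uniform[OF zs_uniform] length_zs by simp

lemma length_image: "length (concat zs) = L * length w"
  using length_concat_uniform[OF zs_uniform] length_zs by simp

lemma L_pos: "0 < L"
  using marker_length by linarith

text \<open>An occurrence at offset \<open>i > 0\<close> of block \<open>q\<close> either stays in
  that block or runs into the next one, which starts with \<open>P\<close>. Both ways it is an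
  occurrence of \<open>P\<close> inside \<open>X @ P\<close> that \<open>marker_unique\<close>
  excludes.\<close>

lemma marker_aligned:
  assumes "k + length P \<le> L * length w" and "\<And>j. j < length P \<Longrightarrow> concat zs ! (k + j) = P ! j"
  shows "L dvd k"
proof (rule ccontr)
  assume "\<not> L dvd k"
  define q i where "q = k div L" and "i = k mod L"
  have k: "k = L * q + i" and i: "0 < i" "i < L"
    using \<open>\<not> L dvd k\<close> L_pos by (auto simp: q_def i_def dvd_eq_mod_eq_0)
  have "L * q < L * length w"
    using assms(1) k i by linarith
  then have q: "q < length w"
    by simp
  note lenq = length_block[OF zs_nth[OF q]]
  have "take (length P) (drop i (zs ! q @ P)) = P"
  proof (rule nth_equalityI)
    fix j assume "j < length (take (length P) (drop i (zs ! q @ P)))"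
    then have j: "j < length P"
      by simp
    have "(zs ! q @ P) ! (i + j) = P ! j"
    proof (cases "i + j < L")
      case True
      then show ?thesis
        using assms(2)[OF j] image_nth[OF q True] lenq by (simp add: k nth_append add.assoc)
    next
      case False
      then obtain r where r: "i + j = L + r"
        using le_Suc_ex not_less by blast
      have rP: "r < length P"
        using r j i by linarith
      have *: "k + j = L * Suc q + r"
        using r k by simp
      have q': "Suc q < length w"
      proof (rule ccontr)
        assume "\<not> Suc q < length w"
        then have "L * length w \<le> L * Suc q"
          by (intro mult_le_mono) auto
        then show False
          using assms(1) * j by linarith
      qed
      have "concat zs ! (k + j) = zs ! Suc q ! r"
        using image_nth[OF q', of r] rP marker_length * by simp
      moreover have "zs ! Suc q ! r = P ! r"
        using block_marker[OF zs_nth[OF q']] rP by (metis nth_take)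
      ultimately show ?thesis
        using assms(2)[OF j] r lenq by (simp add: nth_append)
    qed
    then show "take (length P) (drop i (zs ! q @ P)) ! j = P ! j"
      using j i lenq by (simp del: drop_append take_append)
  qed (use lenq i in simp)
  then show False
    using marker_unique[OF zs_nth[OF q] i] by blast
qed

text \<open>The first half of the square is long enough to contain the whole marker of some block;
  its copy at distance \<open>p\<close> must again be aligned.\<close>

lemma long_square_period:
  assumes "has_run (concat zs) s p p" "L + length P - 1 \<le> p"
  shows "L dvd p"
proof -
  \<comment> \<open>This is \<open>s / L\<close> rounded up: the first block boundary not before
    \<open>s\<close>, at distance at most \<open>L - 1\<close>.\<close>
  define q where "q = (s + L - 1) div L"
  have "L * q \<le> s + L - 1" "s + L - 1 < L * q + L"
    using L_pos by (simp_all add: q_def) (metis dividend_less_times_div add.commute)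
  then have q: "s \<le> L * q" "L * q < s + L"
    using L_pos by linarith+
  have run: "s + p + p \<le> L * length w" "\<And>j. j < p \<Longrightarrow> concat zs ! (s + j) = concat zs ! (s + p + j)"
    using assms(1) by (auto simp: has_run_def length_image)
  have "L * q < L * length w"
    using q run assms(2) marker_length by linarith
  then have ql: "q < length w"
    by simp
  have "L dvd L * q + p"
  proof (rule marker_aligned)
    show "L * q + p + length P \<le> L * length w"
      using q run assms(2) marker_length by linarith
    fix j assume j: "j < length P"
    have "concat zs ! (L * q + j) = concat zs ! (L * q + p + j)"
      using run(2)[of "L * q - s + j"] q j assms(2) by (simp add: add_ac)
    moreover have "concat zs ! (L * q + j) = zs ! q ! j"
      using image_nth[OF ql, of j] j marker_length by simp
    moreover have "zs ! q ! j = P ! j"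
      using block_marker[OF zs_nth[OF ql]] j by (metis nth_take)
    ultimately show "concat zs ! (L * q + p + j) = P ! j"
      by simp
  qed
  then show ?thesis
    by (simp add: dvd_add_right_iff)
qed

text \<open>The \<open>k - 1\<close> blocks strictly inside the first half equal their copies
  \<open>k\<close> blocks later. One more letter comes from a block only partly covered: block
  \<open>q\<close> through its part after \<open>t\<close> if \<open>i \<le> t\<close>, and block
  \<open>q + k\<close> through its part before \<open>t\<close> otherwise. Either way
  \<open>w\<close> has a square of period \<open>k\<close>.\<close>

lemma square_period_not_multiple:
  assumes "squarefree w" "0 < k"
  shows "\<not> has_run (concat zs) s (L * k) (L * k)"
proof
  assume "has_run (concat zs) s (L * k) (L * k)"
  then have run: "s + L * k + L * k \<le> L * length w"
    "\<And>j. j < L * k \<Longrightarrow> concat zs ! (s + j) = concat zs ! (s + L * k + j)"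
    by (auto simp: has_run_def length_image)
  define q i where "q = s div L" and "i = s mod L"
  have s: "s = L * q + i" and i: "i < L"
    using L_pos by (auto simp: q_def i_def)
  have qle: "q + 2 * k \<le> length w"
  proof -
    have "L * (q + 2 * k) \<le> L * length w"
      using run(1) s by (simp add: algebra_simps)
    then show ?thesis using L_pos by simp
  qed
  have agree: "zs ! (q + c) ! r = zs ! (q + c + k) ! r"
    if "L * c + r < L * k + i" "i \<le> L * c + r" "r < L" "q + c + k < length w" for c r
  proof -
    have "concat zs ! (L * (q + c) + r) = concat zs ! (L * (q + c + k) + r)"
      using run(2)[of "L * c + r - i"] that by (simp add: s algebra_simps)
    then show ?thesis
      using image_nth[of "q + c" r] image_nth[of "q + c + k" r] that by simp
  qed
  have lens: "length (zs ! c) = L" if "c < length w" for c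
    using length_block[OF zs_nth[OF that]] .
  have inner: "w ! (q + c) = w ! (q + c + k)" if c: "0 < c" "c < k" for c
  proof -
    have "L * Suc c \<le> L * k"
      using c by (intro mult_le_mono) auto
    moreover have "L * 1 \<le> L * c"
      using c by (intro mult_le_mono) auto
    ultimately have "i \<le> L * c + r" "r < L \<Longrightarrow> L * c + r < L * k + i" for r
      using i by (simp_all only: mult_Suc_right mult_1_right)
    then have "zs ! (q + c) = zs ! (q + c + k)"
      using c qle by (intro nth_equalityI) (auto simp: lens intro!: agree)
    then show ?thesis
      using prefixes_differ[OF zs_nth zs_nth, of "q + c" "q + c + k"] qle c by auto
  qed
  show False
  proof (cases "i \<le> t")
    case True
    have "drop t (zs ! q) = drop t (zs ! (q + k))"
    proof (rule nth_equalityI)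
      fix r assume "r < length (drop t (zs ! q))"
      then have r: "t + r < L"
        using lens[of q] qle assms(2) by auto
      have "L * 1 \<le> L * k"
        using assms(2) by (intro mult_le_mono) auto
      then have "t + r < L * k + i"
        using r by linarith
      then show "drop t (zs ! q) ! r = drop t (zs ! (q + k)) ! r"
        using r True qle assms(2) agree[of 0 "t + r"] lens by simp
    qed (use qle lens assms(2) in auto)
    then have "w ! q = w ! (q + k)"
      using suffixes_differ[OF zs_nth zs_nth, of q "q + k"] qle assms(2) by auto
    then have "w ! (q + c) = w ! (q + k + c)" if "c < k" for c
      using inner[of c] that by (cases "c = 0") (auto simp: add_ac)
    then have "has_run w q k k"
      using qle by (auto simp: has_run_def)
    then show False
      using assms by (auto simp: avoids_runs_def)
  next
    case False
    \<comment> \<open>As \<open>i > t\<close>, the square does not end at a block boundary, so block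
      \<open>q + 2 * k\<close> exists.\<close>
    have qlt: "q + 2 * k < length w"
    proof -
      have "L * (q + 2 * k) < L * length w"
        using run(1) s False by (simp add: algebra_simps)
      then show ?thesis by simp
    qed
    have "take t (zs ! (q + k)) = take t (zs ! (q + k + k))"
    proof (rule nth_equalityI)
      fix r assume r: "r < length (take t (zs ! (q + k)))"
      have "L * 1 \<le> L * k"
        using assms(2) by (intro mult_le_mono) auto
      then have "i \<le> L * k + r"
        using i by linarith
      then show "take t (zs ! (q + k)) ! r = take t (zs ! (q + k + k)) ! r"
        using r agree[of k r] False i qlt t_le by simp
    qed (use qlt lens in auto)
    then have "w ! (q + k) = w ! (q + k + k)"
      using prefixes_differ[OF zs_nth zs_nth, of "q + k" "q + k + k"] qlt by auto
    then have "w ! (q + Suc c) = w ! (q + Suc c + k)" if "c < k" for c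
      using inner[of "Suc c"] that by (cases "Suc c = k") auto
    then have "has_run w (Suc q) k k"
      using qlt by (auto simp: has_run_def add_ac)
    then show False
      using assms by (auto simp: avoids_runs_def)
  qed
qed

lemma short_run_in_four_blocks:
  assumes "has_run (concat zs) s p l" "p + l \<le> 3 * L + 1" "4 \<le> length w"
  obtains c where "c + 4 \<le> length w" "has_run (concat (take 4 (drop c zs))) (s - L * c) p l"
proof -
  \<comment> \<open>A factor of length \<open>3 * L + 1\<close> starting at offset at most
    \<open>L - 1\<close> ends within \<open>4 * L\<close>. The minimum handles runs starting in the
    last three blocks, for which the last four blocks are taken.\<close>
  define c where "c = min (s div L) (length w - 4)"
  have c4: "c + 4 \<le> length w"
    using assms(3) by (simp add: c_def)
  have "L * c \<le> L * (s div L)"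
    by (simp add: c_def)
  also have "\<dots> \<le> s"
    by simp
  finally have cs: "L * c \<le> s" .
  have run: "s + p + l \<le> L * length w" "\<And>j. j < l \<Longrightarrow> concat zs ! (s + j) = concat zs ! (s + p + j)"
    using assms(1) by (auto simp: has_run_def length_image)
  have end_le: "s + p + l \<le> L * c + 4 * L"
  proof (cases "s div L \<le> length w - 4")
    case True
    then have "s < L * c + L"
      using L_pos by (simp add: c_def) (metis dividend_less_times_div add.commute)
    then show ?thesis
      using assms(2) by linarith
  next
    case False
    then have "c + 4 = length w"
      using assms(3) by (simp add: c_def)
    then show ?thesis
      using run(1) by (metis distrib_left mult.commute)
  qed
  define Y where "Y = concat (take 4 (drop c zs))"
  have split: "concat zs = concat (take c zs) @ Y @ concat (drop (c + 4) zs)"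
    unfolding Y_def concat_append[symmetric] by (metis add.commute append_take_drop_id drop_drop)
  have l1: "length (concat (take c zs)) = L * c"
    using length_concat_uniform[of "take c zs" L] zs_uniform c4 length_zs
    by (auto dest: in_set_takeD)
  have l2: "length Y = L * 4"
    using length_concat_uniform[of "take 4 (drop c zs)" L] zs_uniform c4 length_zs
    by (auto dest: in_set_takeD in_set_dropD simp: Y_def)
  have nthY: "concat zs ! (L * c + j) = Y ! j" if "j < 4 * L" for j
    using that by (simp add: split nth_append l1 l2)
  have "has_run Y (s - L * c) p l"
    unfolding has_run_def
  proof (intro conjI allI impI)
    show "s - L * c + p + l \<le> length Y"
      using end_le cs l2 by linarith
    fix j assume "j < l"
    then show "Y ! (s - L * c + j) = Y ! (s - L * c + p + j)"
      using run(2)[of j] nthY[of "s - L * c + j"] nthY[of "s - L * c + p + j"] cs end_le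
      by (simp add: add.assoc[symmetric])
  qed
  then show thesis
    using that c4 by (simp add: Y_def)
qed

theorem image_avoids_runs:
  assumes w: "squarefree w" and "4 \<le> length w"
  shows "avoids_runs f (concat zs)"
  unfolding avoids_runs_def
proof (intro allI impI notI)
  fix p s assume p: "0 < p" and run: "has_run (concat zs) s p (f p)"
  show False
  proof (cases "p < L + length P - 1")
    case True
    then obtain c where c: "c + 4 \<le> length w"
      "has_run (concat (take 4 (drop c zs))) (s - L * c) p (f p)"
      using short_run_in_four_blocks[OF run] short_run_length assms(2) by blast
    have "take 4 (drop c zs) \<in> set (product_lists (map H (take 4 (drop c w))))"
      using zs by (auto simp: product_lists_set take_map[symmetric] drop_map[symmetric]
        intro!: list_all2_takeI list_all2_dropI)
    moreover have "squarefree (take 4 (drop c w))"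
      using w by (rule avoids_runs_sublist) (metis sublist_order.order_trans sublist_take sublist_drop)
    ultimately show False
      using short_runs c p True by fastforce
  next
    case False
    have sq: "has_run (concat zs) s p p"
      using run period_le by (rule has_run_mono)
    then obtain k where k: "p = L * k"
      using long_square_period False by (meson dvd_def not_less)
    then show False
      using square_period_not_multiple[OF w, of k s] sq p by simp
  qed
qed

end

end

section \<open>Squarefree ternary words\<close>

datatype letter = L0 | L1 | L2

definition squarefree_quads :: "letter list list" where
  "squarefree_quads =
    [[L0, L1, L0, L2], [L0, L1, L2, L0], [L0, L1, L2, L1],
     [L0, L2, L0, L1], [L0, L2, L1, L0], [L0, L2, L1, L2],
     [L1, L0, L1, L2], [L1, L0, L2, L0], [L1, L0, L2, L1],
     [L1, L2, L0, L1], [L1, L2, L0, L2], [L1, L2, L1, L0],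
     [L2, L0, L1, L0], [L2, L0, L1, L2], [L2, L0, L2, L1],
     [L2, L1, L0, L1], [L2, L1, L0, L2], [L2, L1, L2, L0]]"

lemma squarefree_four:
  assumes "squarefree w" "length w = 4"
  shows "w \<in> set squarefree_quads"
proof -
  obtain a b c d where w: "w = [a, b, c, d]"
    using assms(2) by (auto simp: numeral_eq_Suc length_Suc_conv)
  have no: "\<not> has_run w s p p" if "0 < p" for s p
    using assms(1) that by (auto simp: avoids_runs_def)
  have "a \<noteq> b" "b \<noteq> c" "c \<noteq> d" "\<not> (a = c \<and> b = d)"
    using no[of 1 0] no[of 1 1] no[of 1 2] no[of 2 0]
    by (auto simp: has_run_def w less_Suc_eq numeral_eq_Suc)
  then show ?thesis
    by (cases a; cases b; cases c; cases d) (simp_all add: w squarefree_quads_def)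
qed

text \<open>Keeping the simplifier out of the arguments of \<^const>\<open>no_run\<close> and \<^const>\<open>no_runs\<close>
  makes each evaluation step independent of the length of the word.\<close>

lemma no_run_cong: "no_run l c xs ys = no_run l c xs ys"
  by (rule refl)

lemma no_runs_cong: "no_runs ls xs ys = no_runs ls xs ys"
  by (rule refl)

fun ternary_block :: "letter \<Rightarrow> letter list" where
  "ternary_block L0 = [L0, L1, L2, L0, L2, L1, L2, L0, L1, L0, L2]"
| "ternary_block L1 = [L0, L1, L2, L1, L0, L2, L0, L1, L0, L2, L1]"
| "ternary_block L2 = [L0, L1, L2, L1, L0, L2, L1, L2, L0, L2, L1]"

text \<open>The periods tested are those below \<open>13 = 11 + 3 - 1\<close>, the threshold of
  \<open>short_runs\<close> for blocks of length 11 and a marker of length 3.\<close>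

lemma ternary_short_runs:
  "\<forall>w\<in>set squarefree_quads. no_short_runs (run_bounds (\<lambda>p. p) 13) (concat (map ternary_block w))"
  by (simp add: squarefree_quads_def run_bounds_def upt_rec numeral_nat del: no_short_runs.simps,
      simp only: no_short_runs.simps,
      simp only: no_run.simps no_runs.simps if_True if_False simp_thms letter.distinct
        cong: if_weak_cong no_run_cong no_runs_cong)

text \<open>The cut 7 is forced: the blocks of \<open>L1\<close> and \<open>L2\<close> differ only
  at indices 6 and 7.\<close>

interpretation ternary: marked_substitution "\<lambda>a. [ternary_block a]" "[L0, L1, L2]" 11 7 "\<lambda>p. p"
proof unfold_locales
  fix a b :: letter and X Y :: "letter list"
  assume X: "X \<in> set [ternary_block a]"
  show "length X = 11" "take (length [L0, L1, L2]) X = [L0, L1, L2]"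
    using X by (cases a; simp)+
  show "take (length [L0, L1, L2]) (drop i (X @ [L0, L1, L2])) \<noteq> [L0, L1, L2]" if "0 < i" "i < 11" for i
  proof -
    have "\<forall>i\<in>set [1..<11]. take 3 (drop i (ternary_block a @ [L0, L1, L2])) \<noteq> [L0, L1, L2]"
      by (cases a; simp add: upt_rec)
    then show ?thesis
      using X that by (simp add: numeral_3_eq_3 del: drop_append take_append)
  qed
  assume Y: "Y \<in> set [ternary_block b]" and "a \<noteq> b"
  then show "take 7 X \<noteq> take 7 Y" "drop 7 X \<noteq> drop 7 Y"
    using X by (cases a; cases b; simp)+
next
  fix w zs p s
  assume w: "squarefree w" "length w = 4"
    and zs: "zs \<in> set (product_lists (map (\<lambda>a. [ternary_block a]) w))"
    and p: "0 < p" "p < 11 + length [L0, L1, L2] - 1"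
  have "zs = map ternary_block w"
    using zs by (auto simp: product_lists_set list_all2_conv_all_nth intro: nth_equalityI)
  then show "\<not> has_run (concat zs) s p p"
    using ternary_short_runs squarefree_four[OF w] p
      no_short_runs_sound[of "\<lambda>p. p" 13 "concat zs" p s] by simp
qed auto

text \<open>The substitution is iterated from a word of length 4, since
  \<open>image_avoids_runs\<close> requires at least four letters.\<close>

lemma squarefree_ternary_power: "\<exists>w :: letter list. squarefree w \<and> length w = 4 * 11 ^ k"
proof (induction k)
  case 0
  have "no_short_runs (run_bounds (\<lambda>p. p) 5) [L0, L1, L0, L2]"
    by (simp add: run_bounds_def upt_rec numeral_nat)
  then have "\<not> has_run [L0, L1, L0, L2] s p p" if "0 < p" for s p
    using no_short_runs_sound[of "\<lambda>p. p" 5 "[L0, L1, L0, L2]" p s] that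
    by (cases "p < 5") (auto simp: has_run_def)
  then have "squarefree [L0, L1, L0, L2]"
    by (simp add: avoids_runs_def)
  then show ?case
    by (intro exI[of _ "[L0, L1, L0, L2]"]) simp
next
  case (Suc k)
  then obtain w :: "letter list" where w: "squarefree w" "length w = 4 * 11 ^ k"
    by blast
  have zs: "map ternary_block w \<in> set (product_lists (map (\<lambda>a. [ternary_block a]) w))"
    by (auto simp: product_lists_set list_all2_conv_all_nth)
  have "squarefree (concat (map ternary_block w))"
    using ternary.image_avoids_runs[OF zs w(1)] w(2) by simp
  moreover have "length (concat (map ternary_block w)) = 4 * 11 ^ Suc k"
    using ternary.length_image[OF zs] w(2) by simp
  ultimately show ?case
    by blast
qed

lemma squarefree_ternary: "\<exists>w :: letter list. squarefree w \<and> length w = n"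
proof -
  obtain w :: "letter list" where w: "squarefree w" "length w = 4 * 11 ^ n"
    using squarefree_ternary_power by blast
  have "n < 11 ^ n"
    by (induction n) auto
  then have "length (take n w) = n"
    using w(2) by simp
  moreover have "squarefree (take n w)"
    using w(1) sublist_take by (rule avoids_runs_sublist)
  ultimately show ?thesis
    by blast
qed

text \<open>A squarefree word over two letters has length at most 3, so each of the \<open>k\<close>
  consecutive factors of length 4 contains \<open>L2\<close>.\<close>

lemma squarefree_ternary_count:
  "squarefree w \<Longrightarrow> length w = 4 * k \<Longrightarrow> k \<le> count_list w L2"
proof (induction k arbitrary: w)
  case (Suc k)
  have "take 4 w \<in> set squarefree_quads"
    using Suc.prems by (intro squarefree_four) (auto intro: avoids_runs_sublist[OF _ sublist_take])
  then have "1 \<le> count_list (take 4 w) L2"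
    by (auto simp: squarefree_quads_def)
  moreover have "k \<le> count_list (drop 4 w) L2"
    using Suc.prems by (intro Suc.IH) (auto intro: avoids_runs_sublist[OF _ sublist_drop])
  moreover have "count_list w L2 = count_list (take 4 w) L2 + count_list (drop 4 w) L2"
    by (metis append_take_drop_id count_list_append)
  ultimately show ?case
    by simp
qed simp

section \<open>The lower bound\<close>

definition word :: "nat list \<Rightarrow> bool list" where
  "word = map (\<lambda>n. n = 1)"

text \<open>The blocks were found by computer search.\<close>

fun binary_blocks :: "letter \<Rightarrow> bool list list" where
  "binary_blocks L0 =
    [word [0,0,1,0,0,1,0,1,1,0,1,0,0,1,1,0,1,1,0,0,1,0,0,1,1,0,1,0,1,1,0,0,1,0,1,0,0,1,1,0,1,1]]"
| "binary_blocks L1 =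
    [word [0,0,1,0,0,1,0,1,1,0,1,0,0,1,1,0,1,1,0,0,1,0,1,0,0,1,1,0,1,1,0,1,0,0,1,0,0,1,1,0,1,1]]"
| "binary_blocks L2 =
    [word [0,0,1,0,0,1,0,1,1,0,1,1,0,0,1,0,1,0,0,1,1,0,1,1,0,0,1,0,0,1,1,0,1,0,0,1,0,1,1,0,1,1],
     word [0,0,1,0,0,1,0,1,1,0,1,1,0,0,1,0,1,0,0,1,1,0,1,1,0,0,1,0,1,1,0,1,0,0,1,0,0,1,1,0,1,1]]"

text \<open>Here the threshold is \<open>49 = 42 + 8 - 1\<close>, and every combination of choices
  for \<open>L2\<close> is tested.\<close>

lemma binary_short_runs:
  "\<forall>w\<in>set squarefree_quads. \<forall>zs\<in>set (product_lists (map binary_blocks w)).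
    no_short_runs (run_bounds cube_bound 49) (concat zs)"
  by (simp add: squarefree_quads_def run_bounds_def cube_bound_def word_def upt_rec numeral_nat
        del: no_short_runs.simps,
      simp only: no_short_runs.simps,
      simp only: no_run.simps no_runs.simps if_True if_False simp_thms
        cong: if_weak_cong no_run_cong no_runs_cong)

abbreviation binary_marker :: "bool list" where
  "binary_marker \<equiv> word [0,0,1,0,0,1,0,1]"

text \<open>The cut 24 leaves room on both sides: \<open>L0\<close> and \<open>L1\<close> first
  differ at index 22, and \<open>L1\<close> and the second image of \<open>L2\<close> last differ at
  index 25.\<close>

interpretation binary: marked_substitution binary_blocks binary_marker 42 24 cube_bound

proof unfold_locales
  have len: "length binary_marker = 8"
    by (simp add: word_def)
  fix a b :: letter and X Y :: "bool list"
  assume X: "X \<in> set (binary_blocks a)"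
  show "length X = 42" "take (length binary_marker) X = binary_marker"
    using X by (cases a; auto simp: word_def)+
  show "take (length binary_marker) (drop i (X @ binary_marker)) \<noteq> binary_marker"
    if "0 < i" "i < 42" for i
  proof -
    have "\<forall>X\<in>set (binary_blocks a). \<forall>i\<in>set [1..<42]. take 8 (drop i (X @ binary_marker)) \<noteq> binary_marker"
      by (cases a; simp add: upt_rec word_def)
    then show ?thesis
      using X that len by (simp del: drop_append take_append)
  qed
  assume Y: "Y \<in> set (binary_blocks b)" and "a \<noteq> b"
  then show "take 24 X \<noteq> take 24 Y" "drop 24 X \<noteq> drop 24 Y"
    using X by (cases a; cases b; auto simp: word_def)+
next
  fix w zs p s
  assume w: "squarefree w" "length w = 4"
    and zs: "zs \<in> set (product_lists (map binary_blocks w))"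
    and p: "0 < p" "p < 42 + length binary_marker - 1"
  have "p < 49"
    using p by (simp add: word_def)
  then show "\<not> has_run (concat zs) s p (cube_bound p)"
    using binary_short_runs squarefree_four[OF w] zs p(1) no_short_runs_sound by blast
qed (auto simp: word_def cube_bound_def)

section \<open>Counting the images\<close>

lemma length_product_binary_blocks:
  "length (product_lists (map binary_blocks w)) = 2 ^ count_list w L2"
proof (induction w)
  case (Cons a w)
  then show ?case
    by (cases a) (simp_all add: length_concat)
qed simp

lemma distinct_binary_blocks: "distinct (binary_blocks a)"
  by (cases a) (simp_all add: word_def)

text \<open>All blocks have the same length, so different choices of images give different words;
  each occurrence of \<open>L2\<close> doubles the number of choices.\<close>

lemma G_lower:
  assumes "0 < k"
  shows "2 ^ k \<le> G (168 * k)"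
proof -
  obtain w :: "letter list" where w: "squarefree w" "length w = 4 * k"
    using squarefree_ternary by blast
  let ?Z = "set (product_lists (map binary_blocks w))"
  have "concat ` ?Z \<subseteq> {u. length u = 168 * k \<and> good u}"
    using binary.length_image binary.image_avoids_runs[OF _ w(1)] w(2) assms by fastforce
  then have "card (concat ` ?Z) \<le> G (168 * k)"
    unfolding G_eq_card_good by (intro card_mono finite_words)
  moreover have "inj_on concat ?Z"
  proof (rule inj_onI)
    fix xs ys assume *: "xs \<in> ?Z" "ys \<in> ?Z" "concat xs = concat ys"
    show "xs = ys"
    proof (rule concat_injective[OF *(3)])
      show "length xs = length ys"
        using *(1,2) binary.length_zs by metis
      show "\<forall>(x, y)\<in>set (zip xs ys). length x = length y"
      proof safe
        fix x y assume "(x, y) \<in> set (zip xs ys)"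
        then show "length x = length y"
          using *(1,2)[THEN binary.zs_uniform] set_zip_leftD set_zip_rightD by metis
      qed
    qed
  qed
  moreover have "card ?Z = 2 ^ count_list w L2"
    unfolding length_product_binary_blocks[symmetric]
    by (intro distinct_card distinct_product_lists) (auto simp: distinct_binary_blocks)
  moreover have "2 ^ k \<le> (2::nat) ^ count_list w L2"
    using squarefree_ternary_count[OF w] by (intro power_increasing) auto
  ultimately show ?thesis
    by (simp only: card_image)
qed

text \<open>A prefix of a good word is good, and the last \<open>n\<close> letters are bounded
  trivially. This carries the lower bound from multiples of 168 to all lengths.\<close>

lemma G_add_le: "G (m + n) \<le> G m * 2 ^ n"
proof -
  let ?S = "{w :: bool list. length w = m \<and> good w}" and ?T = "{w :: bool list. length w = n}"
  have "{w :: bool list. length w = m + n \<and> good w} \<subseteq> (\<lambda>(u, v). u @ v) ` (?S \<times> ?T)"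
  proof
    fix w :: "bool list" assume w: "w \<in> {w. length w = m + n \<and> good w}"
    then have "take m w \<in> ?S" "drop m w \<in> ?T"
      by (auto intro: avoids_runs_sublist[OF _ sublist_take])
    then show "w \<in> (\<lambda>(u, v). u @ v) ` (?S \<times> ?T)"
      by (intro image_eqI[of _ _ "(take m w, drop m w)"]) auto
  qed
  moreover have fin: "finite ?T" and card: "card ?T = 2 ^ n"
    using finite_lists_length_eq[of "UNIV :: bool set" n] card_lists_length_eq[of "UNIV :: bool set" n]
    by simp_all
  ultimately have "G (m + n) \<le> card ((\<lambda>(u, v). u @ v) ` (?S \<times> ?T))"
    unfolding G_eq_card_good by (intro card_mono) (auto intro: finite_words)
  also have "\<dots> \<le> card (?S \<times> ?T)"
    by (intro card_image_le) (auto intro: finite_words fin)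
  finally show ?thesis
    by (simp add: card_cartesian_product card G_eq_card_good)
qed

lemma G_bigomega: "(\<lambda>n. real (G n)) \<in> \<Omega>(\<lambda>n. (1.002 :: real) ^ n)"
proof (rule landau_omega.bigI[of "1 / 2 ^ 168"])
  show "\<forall>\<^sub>F n in at_top. 1 / 2 ^ 168 * norm ((1.002 :: real) ^ n) \<le> norm (real (G n))"
  proof (intro always_eventually allI)
    fix n
    \<comment> \<open>\<open>168 * k\<close> is the least multiple of 168 above \<open>n\<close>; it
      is positive, as \<open>G_lower\<close> requires, and the excess of at most 168 letters costs a
      constant factor.\<close>
    define k where "k = Suc (n div 168)"
    obtain d where d: "168 * k = n + d" "d \<le> 168"
    proof
      have "168 * (n div 168) + n mod 168 = n" "n mod 168 < 168"
        by simp_all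
      then show "168 * k = n + (168 - n mod 168)"
        unfolding k_def mult_Suc_right by linarith
    qed simp
    have "(1.002 :: real) ^ n \<le> 1.002 ^ (168 * k)"
      using d by (intro power_increasing) auto
    also have "\<dots> = (1.002 ^ 168) ^ k"
      by (simp only: power_mult)
    also have "\<dots> \<le> 2 ^ k"
      by (intro power_mono) (simp_all add: power_divide)
    also have "\<dots> = real (2 ^ k)"
      by simp
    also have "\<dots> \<le> real (G n * 2 ^ d)"
      using G_lower[of k] G_add_le[of n d] d(1) by (intro of_nat_mono) (simp add: k_def)
    also have "\<dots> = real (G n) * 2 ^ d"
      by simp
    also have "\<dots> \<le> real (G n) * 2 ^ 168"
      using d(2) by (intro mult_left_mono power_increasing) auto
    finally show "1 / 2 ^ 168 * norm ((1.002 :: real) ^ n) \<le> norm (real (G n))"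
      by (simp only: norm_power norm_of_nat real_norm_def) (simp add: field_simps)
  qed
qed simp

section \<open>The upper bound\<close>

text \<open>A certificate is a binary trie whose inner nodes are the remembered suffixes with their weights.
  At a leaf reached by a word \<open>u\<close>, \<open>Dead p\<close> records that \<open>u\<close> ends in a forbidden power of period
  \<open>p\<close>, and \<open>Jump d\<close> that \<open>drop d u\<close> is an inner node.\<close>

datatype cert = Dead nat | Jump nat | Node nat cert cert

fun subcert :: "cert \<Rightarrow> bool list \<Rightarrow> cert" where
  "subcert (Node v l r) (x # xs) = subcert (if x then r else l) xs"
| "subcert T xs = T"

text \<open>Leaves get weight 0, so a positive weight certifies that a jump lands on an inner
  node.\<close>

fun weight :: "cert \<Rightarrow> nat" where
  "weight (Node v l r) = v"
| "weight T = 0"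

fun bound :: "cert \<Rightarrow> bool list \<Rightarrow> cert \<Rightarrow> nat" where
  "bound T u (Dead p) = 0"
| "bound T u (Jump d) = weight (subcert T (drop d u))"
| "bound T u (Node v l r) = v"

text \<open>The inequality is the growth condition with factor 1.178, cleared of denominators.
  Positive weights bound the single extension of length 0. The test for \<open>Dead p\<close>
  compares the last \<open>cube_bound p\<close> letters of \<open>u\<close> with those
  \<open>p\<close> places earlier.\<close>

fun valid :: "cert \<Rightarrow> bool list \<Rightarrow> cert \<Rightarrow> bool" where
  "valid T u (Dead p) \<longleftrightarrow> 0 < p \<and> p + cube_bound p \<le> length u \<and>
    take (cube_bound p) (drop (length u - (p + cube_bound p)) u) = drop (length u - cube_bound p) u"
| "valid T u (Jump d) \<longleftrightarrow> 0 < weight (subcert T (drop d u))"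
| "valid T u (Node v l r) \<longleftrightarrow> 0 < v \<and>
    1000 * (bound T (u @ [False]) l + bound T (u @ [True]) r) \<le> 1178 * v \<and>
    valid T (u @ [False]) l \<and> valid T (u @ [True]) r"

section \<open>Counting good extensions\<close>

abbreviation extensions :: "bool list \<Rightarrow> nat \<Rightarrow> bool list set" where
  "extensions u n \<equiv> {w. length w = n \<and> good (u @ w)}"

lemma card_extensions_0: "card (extensions u 0) \<le> 1"
  using card_mono[of "{[]}" "extensions u 0"] by auto

lemma card_extensions_Suc:
  "card (extensions u (Suc n)) \<le> card (extensions (u @ [False]) n) + card (extensions (u @ [True]) n)"
proof -
  have "extensions u (Suc n) \<subseteq>
    (#) False ` extensions (u @ [False]) n \<union> (#) True ` extensions (u @ [True]) n"
  proof
    fix w assume "w \<in> extensions u (Suc n)"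
    then obtain x v where "w = x # v" "length v = n" "good (u @ x # v)"
      by (auto simp: length_Suc_conv)
    then show "w \<in> (#) False ` extensions (u @ [False]) n \<union> (#) True ` extensions (u @ [True]) n"
      by (cases x) auto
  qed
  then have "card (extensions u (Suc n)) \<le>
    card ((#) False ` extensions (u @ [False]) n \<union> (#) True ` extensions (u @ [True]) n)"
    by (intro card_mono finite_UnI finite_imageI finite_words)
  also have "\<dots> \<le> card ((#) False ` extensions (u @ [False]) n) + card ((#) True ` extensions (u @ [True]) n)"
    by (rule card_Un_le)
  finally show ?thesis
    by (simp add: card_image)
qed

text \<open>Forgetting a prefix of \<open>u\<close> only weakens the constraint on \<open>w\<close>;
  this is what makes jumps sound.\<close>

lemma card_extensions_drop: "card (extensions u n) \<le> card (extensions (drop d u) n)"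
proof (rule card_mono[OF finite_words], safe)
  fix w assume "good (u @ w)"
  then show "good (drop d u @ w)"
    by (rule avoids_runs_sublist)
      (metis append_take_drop_id append.assoc append_Nil2 sublist_appendI)
qed

lemma valid_subcert:
  "valid T u S \<Longrightarrow> subcert S v = Node c l r \<Longrightarrow> valid T (u @ v) (Node c l r)"
proof (induction v arbitrary: u S)
  case Nil
  then show ?case
    by (cases S) auto
next
  case (Cons x v)
  then show ?case
  proof (cases S)
    case (Node c' l' r')
    then have "valid T (u @ [x]) (if x then r' else l')" "subcert (if x then r' else l') v = Node c l r"
      using Cons.prems by (auto split: if_splits)
    then have "valid T ((u @ [x]) @ v) (Node c l r)"
      by (rule Cons.IH)
    then show ?thesis
      by simp
  qed auto
qed

text \<open>This reduces a bound at all positions of the trie to inner nodes: at \<open>Dead\<close>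
  there are no extensions, and \<open>Jump\<close> leads to an inner node for the same
  \<open>n\<close>. It serves both cases of the induction that follows, with \<open>x\<close> as the
  power of 1.178.\<close>

lemma card_extensions_le_bound:
  assumes "valid T [] T" "valid T u S"
    and "\<And>u c l r. valid T u (Node c l r) \<Longrightarrow> real (card (extensions u n)) \<le> real c * x"
  shows "real (card (extensions u n)) \<le> real (bound T u S) * x"
proof (cases S)
  case (Dead p)
  let ?s = "length u - (p + cube_bound p)"
  have p: "0 < p" "p + cube_bound p \<le> length u"
    and eq: "take (cube_bound p) (drop ?s u) = drop (length u - cube_bound p) u"
    using assms(2) Dead by auto
  have "u ! (?s + j) = u ! (?s + p + j)" if "j < cube_bound p" for j
    using arg_cong[OF eq, of "\<lambda>xs. xs ! j"] that p by simp
  then have "has_run u ?s p (cube_bound p)"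
    using p by (auto simp: has_run_def)
  then have "\<not> good u"
    using p by (auto simp: avoids_runs_def)
  then have "card (extensions u n) = card ({} :: bool list set)"
    using avoids_runs_sublist[of cube_bound _ u] sublist_append_rightI[of u]
    by (intro arg_cong[of _ _ card]) blast
  then show ?thesis
    by (simp add: Dead)
next
  case (Jump d)
  then have "0 < weight (subcert T (drop d u))"
    using assms(2) by simp
  then obtain c l r where sub: "subcert T (drop d u) = Node c l r"
    by (cases "subcert T (drop d u)") auto
  then have "valid T (drop d u) (Node c l r)"
    using valid_subcert[OF assms(1)] by fastforce
  then have "real (card (extensions (drop d u) n)) \<le> real c * x"
    by (rule assms(3))
  then show ?thesis
    using card_extensions_drop[of n u d] Jump sub by simp
next
  case (Node c l r)
  then show ?thesis
    using assms(2,3) by simp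
qed

lemma card_extensions_le:
  assumes "valid T [] T" "valid T u S"
  shows "real (card (extensions u n)) \<le> real (bound T u S) * 1.178 ^ n"
  using assms(2)
proof (induction n arbitrary: u S)
  case 0
  show ?case
  proof (rule card_extensions_le_bound[OF assms(1) 0])
    fix u c l r assume "valid T u (Node c l r)"
    then show "real (card (extensions u 0)) \<le> real c * 1.178 ^ 0"
      using card_extensions_0[of u] by simp
  qed
next
  case (Suc n)
  show ?case
  proof (rule card_extensions_le_bound[OF assms(1) Suc.prems])
    fix u c l r assume v: "valid T u (Node c l r)"
    let ?l = "bound T (u @ [False]) l" and ?r = "bound T (u @ [True]) r"
    have "real (1000 * (?l + ?r)) \<le> real (1178 * c)"
      using v by (intro of_nat_mono) simp
    then have "real ?l + real ?r \<le> 1.178 * real c"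
      by simp
    have "real (card (extensions u (Suc n))) \<le>
      real (card (extensions (u @ [False]) n)) + real (card (extensions (u @ [True]) n))"
      using card_extensions_Suc[of n u] by linarith
    also have "\<dots> \<le> real ?l * 1.178 ^ n + real ?r * 1.178 ^ n"
      using v by (intro add_mono Suc.IH) auto
    also have "\<dots> = (real ?l + real ?r) * 1.178 ^ n"
      by (simp add: distrib_right)
    also have "\<dots> \<le> 1.178 * real c * 1.178 ^ n"
      using \<open>real ?l + real ?r \<le> 1.178 * real c\<close> by (rule mult_right_mono) simp
    finally show "real (card (extensions u (Suc n))) \<le> real c * 1.178 ^ Suc n"
      by (simp add: mult_ac)
  qed
qed

text \<open>The inner nodes are the proper prefixes of 34 suitably chosen cubes and squares of period at
  most 12; the weights are the least positive integers satisfying the required inequalities.\<close>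

definition growth_cert :: cert where
  "growth_cert =
     Node 3140 (Node 1849 (Node 1000 (Dead 1) (Jump 1)) (Node 1177 (Node 785 (Node 394 (Dead 1)
     (Node 463 (Node 285 (Node 159 (Dead 1) (Node 187 (Dead 3) (Jump 1))) (Node 176 (Node 1 (Node 1
     (Dead 1) (Dead 5)) (Dead 2)) (Node 206 (Node 242 (Node 74 (Dead 1) (Node 87 (Node 101 (Node 118
     (Dead 1) (Node 138 (Node 2 (Dead 3) (Node 2 (Jump 9) (Node 1 (Dead 9) (Dead 1)))) (Jump 4)))
     (Dead 6)) (Jump 5))) (Jump 1)) (Dead 1)))) (Node 260 (Node 306 (Jump 1) (Node 359 (Node 225
     (Node 152 (Dead 1) (Node 179 (Jump 3) (Dead 6))) (Jump 3)) (Node 197 (Node 231 (Node 160 (Dead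
     1) (Node 188 (Node 220 (Node 137 (Dead 1) (Node 161 (Jump 5) (Node 77 (Node 90 (Jump 11) (Node
     104 (Jump 5) (Node 1 (Dead 10) (Dead 1)))) (Dead 1)))) (Node 121 (Node 69 (Node 81 (Dead 1)
     (Node 95 (Dead 5) (Node 111 (Node 130 (Jump 13) (Node 152 (Jump 11) (Node 82 (Node 96 (Node 1
     (Dead 1) (Dead 12)) (Jump 12)) (Dead 1)))) (Dead 1)))) (Dead 2)) (Jump 3))) (Jump 6))) (Node
     112 (Node 131 (Node 153 (Dead 1) (Node 180 (Jump 6) (Node 2 (Node 2 (Jump 10) (Node 1 (Dead 6)
     (Dead 9))) (Dead 1)))) (Jump 5)) (Dead 3))) (Dead 1)))) (Dead 1)))) (Node 530 (Node 287 (Jump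
     1) (Dead 2)) (Node 337 (Node 396 (Node 181 (Dead 1) (Node 213 (Node 249 (Jump 1) (Node 96 (Jump
     4) (Node 1 (Dead 6) (Dead 1)))) (Jump 2))) (Jump 1)) (Dead 1)))) (Node 601 (Node 707 (Node 349
     (Dead 1) (Node 411 (Jump 2) (Node 1 (Dead 4) (Dead 1)))) (Node 483 (Node 300 (Node 241 (Dead 1)
     (Node 283 (Node 210 (Node 131 (Dead 1) (Node 154 (Dead 3) (Node 181 (Node 213 (Jump 7) (Node
     249 (Node 96 (Node 1 (Dead 1) (Node 1 (Dead 9) (Dead 6))) (Jump 9)) (Jump 6))) (Dead 1))))
     (Node 116 (Jump 3) (Node 135 (Node 159 (Jump 3) (Node 113 (Node 2 (Node 1 (Dead 1) (Dead 8))
     (Jump 7)) (Jump 4))) (Dead 1)))) (Node 123 (Node 144 (Jump 4) (Node 168 (Dead 6) (Jump 3)))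
     (Dead 1)))) (Node 112 (Dead 2) (Node 131 (Node 154 (Jump 3) (Dead 5)) (Dead 1)))) (Node 268
     (Node 315 (Node 220 (Dead 1) (Node 258 (Node 302 (Jump 2) (Node 158 (Jump 5) (Node 73 (Node 85
     (Dead 6) (Node 100 (Jump 5) (Node 1 (Node 1 (Node 1 (Dead 1) (Dead 9)) (Dead 3)) (Dead 1))))
     (Dead 1)))) (Jump 3))) (Node 150 (Jump 2) (Dead 3))) (Dead 1)))) (Dead 1)))) (Node 1849 (Node
     1177 (Node 601 (Dead 1) (Node 707 (Node 483 (Node 268 (Dead 1) (Node 315 (Node 150 (Dead 3)
     (Jump 2)) (Node 220 (Node 258 (Jump 3) (Node 302 (Node 158 (Node 73 (Dead 1) (Node 85 (Node 100
     (Node 1 (Dead 1) (Node 1 (Dead 3) (Node 1 (Dead 9) (Dead 1)))) (Jump 5)) (Dead 6))) (Jump 5))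
     (Jump 2))) (Dead 1)))) (Node 300 (Node 112 (Node 131 (Dead 1) (Node 154 (Dead 5) (Jump 3)))
     (Dead 2)) (Node 241 (Node 283 (Node 123 (Dead 1) (Node 144 (Node 168 (Jump 3) (Dead 6)) (Jump
     4))) (Node 210 (Node 116 (Node 135 (Dead 1) (Node 159 (Node 113 (Jump 4) (Node 2 (Jump 7) (Node
     1 (Dead 8) (Dead 1)))) (Jump 3))) (Jump 3)) (Node 131 (Node 154 (Node 181 (Dead 1) (Node 213
     (Node 249 (Jump 6) (Node 96 (Jump 9) (Node 1 (Node 1 (Dead 6) (Dead 9)) (Dead 1)))) (Jump 7)))
     (Dead 3)) (Dead 1)))) (Dead 1)))) (Node 349 (Node 411 (Node 1 (Dead 1) (Dead 4)) (Jump 2))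
     (Dead 1)))) (Node 785 (Node 530 (Node 337 (Dead 1) (Node 396 (Jump 1) (Node 181 (Node 213 (Jump
     2) (Node 249 (Node 96 (Node 1 (Dead 1) (Dead 6)) (Jump 4)) (Jump 1))) (Dead 1)))) (Node 287
     (Dead 2) (Jump 1))) (Node 394 (Node 463 (Node 260 (Dead 1) (Node 306 (Node 359 (Node 197 (Dead
     1) (Node 231 (Node 112 (Dead 3) (Node 131 (Jump 5) (Node 153 (Node 180 (Node 2 (Dead 1) (Node 2
     (Node 1 (Dead 9) (Dead 6)) (Jump 10))) (Jump 6)) (Dead 1)))) (Node 160 (Node 188 (Jump 6) (Node
     220 (Node 121 (Jump 3) (Node 69 (Dead 2) (Node 81 (Node 95 (Node 111 (Dead 1) (Node 130 (Node
     152 (Node 82 (Dead 1) (Node 96 (Jump 12) (Node 1 (Dead 12) (Dead 1)))) (Jump 11)) (Jump 13)))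
     (Dead 5)) (Dead 1)))) (Node 137 (Node 161 (Node 77 (Dead 1) (Node 90 (Node 104 (Node 1 (Dead 1)
     (Dead 10)) (Jump 5)) (Jump 11))) (Jump 5)) (Dead 1)))) (Dead 1)))) (Node 225 (Jump 3) (Node 152
     (Node 179 (Dead 6) (Jump 3)) (Dead 1)))) (Jump 1))) (Node 285 (Node 176 (Node 206 (Dead 1)
     (Node 242 (Jump 1) (Node 74 (Node 87 (Jump 5) (Node 101 (Dead 6) (Node 118 (Node 138 (Jump 4)
     (Node 2 (Node 2 (Node 1 (Dead 1) (Dead 9)) (Jump 9)) (Dead 3))) (Dead 1)))) (Dead 1)))) (Node 1
     (Dead 2) (Node 1 (Dead 5) (Dead 1)))) (Node 159 (Node 187 (Jump 1) (Dead 3)) (Dead 1)))) (Dead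
     1)))) (Node 1000 (Jump 1) (Dead 1)))"

lemma valid_growth_cert: "valid growth_cert [] growth_cert"
  unfolding growth_cert_def by (simp add: cube_bound_def)

lemma G_bigo: "(\<lambda>n. real (G n)) \<in> O(\<lambda>n. (1.178 :: real) ^ n)"
proof (rule landau_o.bigI)
  \<comment> \<open>The constant 3140 is the weight of the root, the empty suffix.\<close>
  show "\<forall>\<^sub>F n in at_top. norm (real (G n)) \<le> 3140 * norm ((1.178 :: real) ^ n)"
  proof (intro always_eventually allI)
    fix n
    have "bound growth_cert [] growth_cert = 3140"
      by (simp add: growth_cert_def)
    then show "norm (real (G n)) \<le> 3140 * norm ((1.178 :: real) ^ n)"
      using card_extensions_le[OF valid_growth_cert valid_growth_cert, of n] by (simp add: G_eq_card_good)
  qed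
qed simp

theorem theorem8:
  shows "(\<lambda>n. real (G n)) \<in> \<Omega>(\<lambda>n. (1.002 :: real) ^ n)
       \<and> (\<lambda>n. real (G n)) \<in> O(\<lambda>n. (1.178 :: real) ^ n)"
  using G_bigomega G_bigo by (rule conjI)

end
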